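(* Let $n\ge 2$ be a finite integer, let $s_1,\dots,s_n$ be the standard generators of the Cuntz algebra $\mathcal{O}_n$ and $t_1,t_2,\dots$ the standard generators of $\mathcal{O}_\infty$. Let $f_{n,\infty}\colon\mathcal{O}_\infty\to\mathcal{O}_n$ be the unital embedding determined by $$f_{n,\infty}(t_{(n-1)k+i}) := s_n^k s_i\qquad (k\ge 0,\ i=1,\dots,n-1),$$ where $s_n^0:=1$. Then the Cuntz family $\{f_{n,\infty}(t_i)\}_{i=1}^\infty$ separates the points of $\mathcal{O}_n$.
   Context: An (infinite) Cuntz family of isometries in a unital C*-algebra $A$ is a sequence $\{v_i\}_{i=1}^{\infty}$ of isometries in $A$ such that $\sum_{i=1}^m v_iv_i^*\le 1_A$ for all $1\le m<\infty$. With $p_i:=v_iv_i^*$, the family separates the points of $A$ if the only $x\in A$ such that $p_i x p_j=0$ for all $i$ and $j$ is $x=0$. *)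

theory Defs
  imports "HOL-Analysis.Analysis"
begin

text \<open>
  Nonzero complex unital C*-algebras. The real vector space structure inherited from
  \<^class>\<open>real_normed_algebra_1\<close> is the restriction of the complex one (axiom
  \<open>scaleR_scaleC\<close>); that class also forces \<open>norm 1 = 1\<close>, hence \<open>0 \<noteq> 1\<close>.
\<close>

class unital_cstar_algebra = real_normed_algebra_1 + banach +
  fixes scaleC :: "complex \<Rightarrow> 'a \<Rightarrow> 'a"  (infixr "*\<^sub>C" 75)
    and star :: "'a \<Rightarrow> 'a"  ("_\<^sup>\<star>" [1000] 999)
  assumes scaleC_add_right: "c *\<^sub>C (x + y) = c *\<^sub>C x + c *\<^sub>C y"
    and scaleC_add_left: "(c + d) *\<^sub>C x = c *\<^sub>C x + d *\<^sub>C x"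
    and scaleC_scaleC: "c *\<^sub>C (d *\<^sub>C x) = (c * d) *\<^sub>C x"
    and scaleR_scaleC: "r *\<^sub>R x = complex_of_real r *\<^sub>C x"
    and mult_scaleC_left: "(c *\<^sub>C x) * y = c *\<^sub>C (x * y)"
    and mult_scaleC_right: "x * (c *\<^sub>C y) = c *\<^sub>C (x * y)"
    and norm_scaleC: "norm (c *\<^sub>C x) = cmod c * norm x"
    and star_star: "(x\<^sup>\<star>)\<^sup>\<star> = x"
    and star_add: "(x + y)\<^sup>\<star> = x\<^sup>\<star> + y\<^sup>\<star>"
    and star_scaleC: "(c *\<^sub>C x)\<^sup>\<star> = cnj c *\<^sub>C x\<^sup>\<star>"
    and star_mult: "(x * y)\<^sup>\<star> = y\<^sup>\<star> * x\<^sup>\<star>"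
    and cstar_identity: "norm (x\<^sup>\<star> * x) = (norm x)\<^sup>2"

definition cstar_spectrum :: "'a::unital_cstar_algebra \<Rightarrow> complex set" where
  "cstar_spectrum a =
     {z. \<not> (\<exists>b. (a - z *\<^sub>C 1) * b = 1 \<and> b * (a - z *\<^sub>C 1) = 1)}"

definition cstar_positive :: "'a::unital_cstar_algebra \<Rightarrow> bool" where
  "cstar_positive a \<longleftrightarrow> a\<^sup>\<star> = a \<and> cstar_spectrum a \<subseteq> \<real>\<^sub>\<ge>\<^sub>0"

definition cstar_le :: "'a::unital_cstar_algebra \<Rightarrow> 'a \<Rightarrow> bool"  (infix "\<preceq>" 50) where
  "a \<preceq> b \<longleftrightarrow> cstar_positive (b - a)"

definition isometry :: "'a::unital_cstar_algebra \<Rightarrow> bool" where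
  "isometry v \<longleftrightarrow> v\<^sup>\<star> * v = 1"

definition cstar_subalgebra :: "'a::unital_cstar_algebra set \<Rightarrow> bool" where
  "cstar_subalgebra B \<longleftrightarrow>
     closed B \<and> 0 \<in> B \<and>
     (\<forall>x\<in>B. \<forall>y\<in>B. x + y \<in> B \<and> x * y \<in> B) \<and>
     (\<forall>x\<in>B. x\<^sup>\<star> \<in> B \<and> (\<forall>c. c *\<^sub>C x \<in> B))"

definition cstar_generated :: "'a::unital_cstar_algebra set \<Rightarrow> 'a set" where
  "cstar_generated S = cstar_subalgebra hull S"

definition unital_star_hom ::
    "('b::unital_cstar_algebra \<Rightarrow> 'a::unital_cstar_algebra) \<Rightarrow> bool" where
  "unital_star_hom f \<longleftrightarrow>
     f 1 = 1 \<and>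
     (\<forall>x y. f (x + y) = f x + f y) \<and>
     (\<forall>c x. f (c *\<^sub>C x) = c *\<^sub>C f x) \<and>
     (\<forall>x y. f (x * y) = f x * f y) \<and>
     (\<forall>x. f (x\<^sup>\<star>) = (f x)\<^sup>\<star>)"

definition unital_embedding ::
    "('b::unital_cstar_algebra \<Rightarrow> 'a::unital_cstar_algebra) \<Rightarrow> bool" where
  "unital_embedding f \<longleftrightarrow> unital_star_hom f \<and> inj f"

text \<open>
  Sequences \<open>v\<^sub>1, v\<^sub>2, \<dots>\<close> are functions on \<^typ>\<open>nat\<close> whose value at \<open>0\<close> is never used.
\<close>

definition cuntz_family :: "(nat \<Rightarrow> 'a::unital_cstar_algebra) \<Rightarrow> bool" where
  "cuntz_family v \<longleftrightarrow>
     (\<forall>i\<ge>1. isometry (v i)) \<and> (\<forall>m\<ge>1. (\<Sum>i=1..m. v i * (v i)\<^sup>\<star>) \<preceq> 1)"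

definition separates_points :: "(nat \<Rightarrow> 'a::unital_cstar_algebra) \<Rightarrow> bool" where
  "separates_points v \<longleftrightarrow>
     {x. \<forall>i\<ge>1. \<forall>j\<ge>1. (v i * (v i)\<^sup>\<star>) * x * (v j * (v j)\<^sup>\<star>) = 0} = {0}"

text \<open>
  By Cuntz's uniqueness theorem the defining relations below determine the generated
  C*-algebra up to an isomorphism matching the generators. The predicates therefore say
  that the ambient algebra is \<open>\<O>\<^sub>n\<close> (resp. \<open>\<O>\<^sub>\<infinity>\<close>) and that the given elements are its
  standard generators.
\<close>

definition cuntz_algebra :: "nat \<Rightarrow> (nat \<Rightarrow> 'a::unital_cstar_algebra) \<Rightarrow> bool" where
  "cuntz_algebra n s \<longleftrightarrow>
     (\<forall>i\<in>{1..n}. isometry (s i)) \<and>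
     (\<Sum>i=1..n. s i * (s i)\<^sup>\<star>) = 1 \<and>
     cstar_generated (s ` {1..n}) = UNIV"

definition cuntz_algebra_infinity :: "(nat \<Rightarrow> 'a::unital_cstar_algebra) \<Rightarrow> bool" where
  "cuntz_algebra_infinity t \<longleftrightarrow>
     cuntz_family t \<and> cstar_generated (t ` {1..}) = UNIV"

end

theory Submission imports Defs begin

text \<open>
  Write \<open>S = s\<^sub>n\<close> and \<open>q\<^sub>K = S\<^sup>K (S\<^sup>K)\<^sup>\<star>\<close>. The range projections of the embedded family with
  \<open>k < K\<close> add up to \<open>1 - q\<^sub>K\<close>, so it suffices that \<open>(1 - q\<^sub>K) x (1 - q\<^sub>L) = 0\<close> for all
  \<open>K\<close>, \<open>L\<close> forces \<open>x = 0\<close>; applying the following twice, to \<open>x (1 - q\<^sub>L)\<close> and to \<open>x\<^sup>\<star>\<close>, this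
  reduces to showing that \<open>q\<^sub>K y = y\<close> for all \<open>K\<close> implies \<open>y = 0\<close>.

  Let \<open>\<Phi>(x) = \<Sum> s\<^sub>i x s\<^sub>i\<^sup>\<star>\<close>, \<open>u = S\<^sup>L s\<^sub>1\<close> and \<open>V = L\<^sup>-\<^sup>1\<^sup>/\<^sup>2 \<Sum> \<Phi>\<^sup>j(u)\<close> over \<open>j < L\<close>. The
  terms \<open>\<Phi>\<^sup>j(u)\<close> are isometries with orthogonal ranges, so \<open>V\<close> is an isometry. Since
  \<open>s\<^sub>i x = \<Phi>(x) s\<^sub>i\<close> shifts the sum by one step, the commutator of \<open>V\<close> with each generator
  telescopes to norm at most \<open>2 / \<surd>L\<close>, and \<open>V\<close> is asymptotically central. On the other hand
  \<open>q\<^sub>K V q\<^sub>K = 0\<close> for \<open>K = 2 L\<close>. Hence \<open>\<parallel>y\<parallel> = \<parallel>V y\<parallel>\<close> is at most twice the norm of \<open>V y - y V\<close>,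
  which tends to \<open>0\<close>. Neither the gauge action nor simplicity of \<open>\<O>\<^sub>n\<close> is needed.
\<close>

section \<open>Arithmetic of complex scalars and of the involution; norms and powers of
  isometries\<close>

lemma scaleC_one [simp]: "1 *\<^sub>C (x::'a::unital_cstar_algebra) = x"
  using scaleR_scaleC[of 1 x] by simp

lemma scaleC_zero_right [simp]: "c *\<^sub>C (0::'a::unital_cstar_algebra) = 0"
  using scaleC_add_right[of c "0::'a" 0] by simp

lemma scaleC_zero_left [simp]: "0 *\<^sub>C (x::'a::unital_cstar_algebra) = 0"
  using scaleR_scaleC[of 0 x] by simp

lemma scaleC_minus_right: "c *\<^sub>C (- x) = - (c *\<^sub>C (x::'a::unital_cstar_algebra))"
  using scaleC_add_right[of c x "- x"] by (simp add: eq_neg_iff_add_eq_0 add.commute)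

lemma scaleC_diff_right: "c *\<^sub>C (x - y) = c *\<^sub>C x - c *\<^sub>C (y::'a::unital_cstar_algebra)"
  using scaleC_add_right[of c x "- y"] by (simp add: scaleC_minus_right)

lemma scaleC_sum_right: "c *\<^sub>C (\<Sum>i\<in>A. g i) = (\<Sum>i\<in>A. c *\<^sub>C (g i::'a::unital_cstar_algebra))"
  by (induction A rule: infinite_finite_induct) (auto simp: scaleC_add_right)

lemma scaleC_sum_left: "(\<Sum>i\<in>A. c i) *\<^sub>C (x::'a::unital_cstar_algebra) = (\<Sum>i\<in>A. c i *\<^sub>C x)"
  by (induction A rule: infinite_finite_induct) (auto simp: scaleC_add_left)

lemma star_0 [simp]: "(0::'a::unital_cstar_algebra)\<^sup>\<star> = 0"
  using star_add[of "0::'a" 0] by simp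

lemma star_1 [simp]: "(1::'a::unital_cstar_algebra)\<^sup>\<star> = 1"
  by (metis mult.right_neutral star_mult star_star)

lemma star_minus: "(- x)\<^sup>\<star> = - (x::'a::unital_cstar_algebra)\<^sup>\<star>"
  using star_add[of x "- x"] by (simp add: eq_neg_iff_add_eq_0 add.commute)

lemma star_diff: "(x - y)\<^sup>\<star> = x\<^sup>\<star> - (y::'a::unital_cstar_algebra)\<^sup>\<star>"
  using star_add[of x "- y"] by (simp add: star_minus)

lemma star_sum: "(\<Sum>i\<in>A. g i)\<^sup>\<star> = (\<Sum>i\<in>A. (g i::'a::unital_cstar_algebra)\<^sup>\<star>)"
  by (induction A rule: infinite_finite_induct) (auto simp: star_add)

lemma star_scaleR: "(r *\<^sub>R x)\<^sup>\<star> = r *\<^sub>R (x::'a::unital_cstar_algebra)\<^sup>\<star>"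
  by (simp add: scaleR_scaleC star_scaleC)

lemma star_power: "(x ^ k)\<^sup>\<star> = ((x::'a::unital_cstar_algebra)\<^sup>\<star>) ^ k"
  by (induction k) (auto simp: star_mult power_commutes)

lemma norm_star: "norm (x\<^sup>\<star>) = norm (x::'a::unital_cstar_algebra)"
proof -
  have le: "norm x \<le> norm (x\<^sup>\<star>)" for x :: 'a
  proof (cases "norm x = 0")
    case False
    have "norm x * norm x \<le> norm (x\<^sup>\<star>) * norm x"
      by (metis cstar_identity norm_mult_ineq power2_eq_square)
    then show ?thesis using False by simp
  qed simp
  show ?thesis using le[of x] le[of "x\<^sup>\<star>"] by (simp add: star_star)
qed

lemma norm_isometry:
  fixes v :: "'a::unital_cstar_algebra"
  assumes "isometry v" shows "norm v = 1"
proof -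
  have "(norm v)\<^sup>2 = 1" using cstar_identity[of v] assms by (simp add: isometry_def)
  then show ?thesis by (simp add: power2_eq_1_iff)
      (metis norm_ge_zero not_one_le_zero neg_0_le_iff_le)
qed

lemma norm_isometry_mult:
  fixes v :: "'a::unital_cstar_algebra"
  assumes "isometry v" shows "norm (v * x) = norm x"
proof -
  have "(v * x)\<^sup>\<star> * (v * x) = x\<^sup>\<star> * (v\<^sup>\<star> * v) * x"
    by (simp add: star_mult mult.assoc)
  then have "(norm (v * x))\<^sup>2 = (norm x)\<^sup>2"
    using assms cstar_identity[of "v * x"] cstar_identity[of x] by (simp add: isometry_def)
  then show ?thesis by simp
qed

lemma norm_mult_le:
  fixes x y :: "'a::unital_cstar_algebra"
  shows "norm x \<le> a \<Longrightarrow> norm y \<le> b \<Longrightarrow> norm (x * y) \<le> a * b"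
  by (meson norm_mult_ineq mult_mono norm_ge_zero order_trans)

lemma isometry_mult:
  fixes v w :: "'a::unital_cstar_algebra"
  assumes "isometry v" "isometry w" shows "isometry (v * w)"
proof -
  have "(v * w)\<^sup>\<star> * (v * w) = w\<^sup>\<star> * (v\<^sup>\<star> * v) * w" by (simp add: star_mult mult.assoc)
  then show ?thesis using assms by (simp add: isometry_def)
qed

lemma isometry_power:
  fixes v :: "'a::unital_cstar_algebra"
  assumes "isometry v" shows "isometry (v ^ k)"
proof (induction k)
  case 0
  show ?case by (simp add: isometry_def)
next
  case (Suc k)
  then show ?case by (simp add: isometry_mult assms)
qed

lemma isometry_cancel_powers:
  fixes v :: "'a::unital_cstar_algebra"
  assumes "isometry v" shows "(v\<^sup>\<star>) ^ k * v ^ (k + l) = v ^ l"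
proof -
  have "(v\<^sup>\<star>) ^ k * v ^ k = 1"
    using isometry_power[OF assms, of k] by (simp add: isometry_def star_power)
  then show ?thesis by (simp add: power_add mult.assoc[symmetric])
qed

lemma isometry_cancel_star_powers:
  fixes v :: "'a::unital_cstar_algebra"
  assumes "isometry v" shows "(v\<^sup>\<star>) ^ (l + k) * v ^ k = (v\<^sup>\<star>) ^ l"
proof -
  have "(v\<^sup>\<star>) ^ k * v ^ k = 1"
    using isometry_power[OF assms, of k] by (simp add: isometry_def star_power)
  then show ?thesis by (simp add: power_add mult.assoc)
qed

text \<open>The complement is a self-adjoint idempotent, so by the C*-identity its norm
  \<open>r\<close> satisfies \<open>r * r = r\<close>.\<close>

lemma norm_complement_range_le_1:
  fixes v :: "'a::unital_cstar_algebra"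
  assumes "isometry v" shows "norm (1 - v * v\<^sup>\<star>) \<le> 1"
proof -
  define p where "p = 1 - v * v\<^sup>\<star>"
  have "(v * v\<^sup>\<star>) * (v * v\<^sup>\<star>) = v * (v\<^sup>\<star> * v) * v\<^sup>\<star>" by (simp add: mult.assoc)
  then have "(v * v\<^sup>\<star>) * (v * v\<^sup>\<star>) = v * v\<^sup>\<star>" using assms by (simp add: isometry_def)
  then have "p\<^sup>\<star> * p = p"
    unfolding p_def by (simp add: star_diff star_mult star_star algebra_simps)
  then have "norm p * norm p = norm p" using cstar_identity[of p] by (simp add: power2_eq_square)
  then show ?thesis unfolding p_def[symmetric] by auto
qed

subsection \<open>Orthogonality of the range projections\<close>

text \<open>
  Averaging \<open>(1 + \<omega>e)\<^sup>N\<close> against \<open>\<omega>\<^sup>N\<close> over the \<open>(N + 1)\<close>-st roots of unity isolates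
  the linear term \<open>N e\<close>; this replaces the usual appeal to Liouville's theorem.
\<close>

lemma eq_0_if_norm_1_plus_circle_le_1:
  fixes e :: "'a::unital_cstar_algebra"
  assumes "\<And>\<omega>. cmod \<omega> = 1 \<Longrightarrow> norm (1 + \<omega> *\<^sub>C e) \<le> 1"
  shows "e = 0"
proof -
  \<comment> \<open>One coefficient sequence has to serve every \<omega>, hence the order of the
    quantifiers. For \<open>N = 0\<close> the value \<open>a 1\<close> lies beyond the sum and is
    arbitrary, hence the guard.\<close>
  have expand: "\<exists>a. (\<forall>\<omega>. (1 + \<omega> *\<^sub>C e) ^ N = (\<Sum>k\<le>N. \<omega> ^ k *\<^sub>C a k)) \<and>
          a 0 = 1 \<and> (N > 0 \<longrightarrow> a 1 = of_nat N * e)" for N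
  proof (induction N)
    case 0
    show ?case by (rule exI[of _ "\<lambda>_. 1"]) simp
  next
    case (Suc N)
    then obtain a where a: "\<And>\<omega>. (1 + \<omega> *\<^sub>C e) ^ N = (\<Sum>k\<le>N. \<omega> ^ k *\<^sub>C a k)"
      "a 0 = 1" "N > 0 \<Longrightarrow> a 1 = of_nat N * e" by blast
    \<comment> \<open>One more factor adds to the old coefficients their shift multiplied by
      \<open>e\<close>. The cutoff discards \<open>a (N + 1)\<close>, about which nothing is
      known.\<close>
    define b where "b k = (if k \<le> N then a k else 0) + (if k = 0 then 0 else e * a (k - 1))" for k
    have "(1 + \<omega> *\<^sub>C e) ^ Suc N = (\<Sum>k\<le>Suc N. \<omega> ^ k *\<^sub>C b k)" for \<omega>
    proof -
      have "(1 + \<omega> *\<^sub>C e) ^ Suc N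
          = (\<Sum>k\<le>N. \<omega> ^ k *\<^sub>C a k) + (\<Sum>k\<le>N. \<omega> ^ Suc k *\<^sub>C (e * a k))"
        by (simp add: a distrib_right mult_scaleC_left mult_scaleC_right sum_distrib_left
            scaleC_sum_right scaleC_scaleC scaleC_add_right sum.distrib mult.commute)
      also have "(\<Sum>k\<le>N. \<omega> ^ k *\<^sub>C a k)
          = (\<Sum>k\<le>Suc N. \<omega> ^ k *\<^sub>C (if k \<le> N then a k else 0))" by simp
      also have "(\<Sum>k\<le>N. \<omega> ^ Suc k *\<^sub>C (e * a k))
          = (\<Sum>k\<le>Suc N. \<omega> ^ k *\<^sub>C (if k = 0 then 0 else e * a (k - 1)))"
        by (subst sum.atMost_Suc_shift) simp
      finally show ?thesis by (simp only: b_def scaleC_add_right sum.distrib)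
    qed
    moreover have "b 0 = 1" "b 1 = of_nat (Suc N) * e"
      using a by (auto simp: b_def distrib_right not_less_eq_eq)
    ultimately show ?case by blast
  qed
  have bound: "real N * norm e \<le> 1" if "N > 0" for N
  proof -
    obtain a where a: "\<And>\<omega>. (1 + \<omega> *\<^sub>C e) ^ N = (\<Sum>k\<le>N. \<omega> ^ k *\<^sub>C a k)"
      "a 1 = of_nat N * e" using expand[of N] \<open>N > 0\<close> by blast
    \<comment> \<open>With \<open>R = N + 1\<close>, the only \<open>k \<le> N\<close> for which
      \<open>R\<close> divides \<open>N + k\<close> is \<open>k = 1\<close>.\<close>
    define R where "R = Suc N"
    define z where "z = cis (2 * pi / of_nat R)"
    have zR: "z ^ R = 1"
    proof -
      have "z ^ R = cis (real R * (2 * pi / real R))" unfolding z_def by (rule Complex.DeMoivre)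
      moreover have "real R \<noteq> 0" by (simp add: R_def)
      ultimately show ?thesis by simp
    qed
    have z1: "z ^ m \<noteq> 1" if "\<not> R dvd m" for m
    proof
      assume "z ^ m = 1"
      then have "cis (2 * pi * real m / real R) = 1"
        unfolding z_def by (simp add: Complex.DeMoivre mult.commute)
      then have "cos (2 * pi * real m / real R) = 1" by (metis cis.sel(1) one_complex.sel(1))
      then obtain i :: int where "2 * pi * real m / real R = real_of_int i * 2 * pi"
        using cos_one_2pi_int by blast
      then have "real m = real_of_int i * real R" by (simp add: field_simps R_def del: of_nat_Suc)
      then have "int m = i * int R" by (metis of_int_eq_iff of_int_mult of_int_of_nat_eq)
      then show False using that by (metis dvd_triv_right int_dvd_int_iff)
    qed
    have orth: "(\<Sum>j<R. (z ^ j) ^ N * (z ^ j) ^ k) = (if k = 1 then of_nat R else 0)"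
      if "k \<le> N" for k
    proof -
      have eq: "(z ^ j) ^ N * (z ^ j) ^ k = (z ^ (N + k)) ^ j" for j
        by (simp add: power_add power_mult_distrib mult.commute flip: power_mult)
      show ?thesis
      proof (cases "k = 1")
        case True
        then have "z ^ (N + k) = 1" using zR by (simp add: R_def)
        then have "(z ^ j) ^ N * (z ^ j) ^ k = 1" for j by (simp add: eq)
        then show ?thesis using True by simp
      next
        case False
        have "\<not> R dvd N + k"
        proof
          assume "R dvd N + k"
          then obtain q where q: "N + k = R * q" by blast
          have "q \<noteq> 0" using q \<open>N > 0\<close> by (intro notI) simp
          moreover have "q \<noteq> 1" using q False by (auto simp: R_def)
          moreover have "q < 2"
          proof (rule ccontr)
            assume "\<not> q < 2"
            then have "R * 2 \<le> R * q" by simp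
            then show False using q \<open>k \<le> N\<close> by (simp add: R_def)
          qed
          ultimately show False by simp
        qed
        then have ne: "z ^ (N + k) \<noteq> 1" by (rule z1)
        have "(z ^ (N + k)) ^ R = 1"
          using zR by (metis power_mult mult.commute power_one)
        then show ?thesis using ne False by (simp add: eq geometric_sum)
      qed
    qed
    have "(\<Sum>j<R. (z ^ j) ^ N *\<^sub>C (1 + z ^ j *\<^sub>C e) ^ N)
        = (\<Sum>j<R. \<Sum>k\<le>N. ((z ^ j) ^ N * (z ^ j) ^ k) *\<^sub>C a k)"
      by (simp add: a(1) scaleC_sum_right scaleC_scaleC)
    also have "\<dots> = (\<Sum>k\<le>N. (\<Sum>j<R. (z ^ j) ^ N * (z ^ j) ^ k) *\<^sub>C a k)"
      by (subst sum.swap) (simp only: scaleC_sum_left)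
    also have "\<dots> = (\<Sum>k\<le>N. if k = 1 then of_nat R *\<^sub>C a k else 0)"
      by (intro sum.cong refl) (simp add: orth)
    also have "\<dots> = of_nat R *\<^sub>C a 1" using that by simp
    finally have "of_nat R *\<^sub>C a 1 = (\<Sum>j<R. (z ^ j) ^ N *\<^sub>C (1 + z ^ j *\<^sub>C e) ^ N)" ..
    then have "real R * norm (a 1) = norm (\<Sum>j<R. (z ^ j) ^ N *\<^sub>C (1 + z ^ j *\<^sub>C e) ^ N)"
      by (metis norm_scaleC norm_of_nat)
    also have "\<dots> \<le> (\<Sum>j<R. 1)"
    proof (rule sum_norm_le)
      fix j
      have u: "cmod (z ^ j) = 1" by (simp add: z_def norm_power)
      have "norm ((1 + z ^ j *\<^sub>C e) ^ N) \<le> 1"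
        using assms[OF u] by (meson norm_power_ineq order_trans power_le_one norm_ge_zero)
      then show "norm ((z ^ j) ^ N *\<^sub>C (1 + z ^ j *\<^sub>C e) ^ N) \<le> 1"
        using u by (simp add: norm_scaleC norm_power)
    qed
    finally have "norm (a 1) \<le> 1" by (simp add: R_def del: of_nat_Suc)
    moreover have "a 1 = real N *\<^sub>R e" by (simp only: a(2) scaleR_conv_of_real of_real_of_nat_eq)
    ultimately show ?thesis by simp
  qed
  show ?thesis
  proof (rule ccontr)
    assume "e \<noteq> 0"
    then obtain N where "1 < real N * norm e" using reals_Archimedean3[of "norm e"] by auto
    moreover from this have "N > 0" by (intro gr0I) simp
    ultimately show False using bound[of N] by simp
  qed
qed

text \<open>Averaging the squares of \<open>1 + e\<close> and \<open>1 - e\<close> bounds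
  \<open>1 + e * e\<close>. As \<open>g = \<i> *\<^sub>C e\<close> is skew-adjoint, the C*-identity
  turns this into bounds for \<open>1 + g\<close> and \<open>1 - g\<close>. By convexity the four
  directions control a whole circle.\<close>

lemma self_adjoint_eq_0_if_norm_1_pm_le_1:
  fixes e :: "'a::unital_cstar_algebra"
  assumes sa: "e\<^sup>\<star> = e" and pos: "norm (1 + e) \<le> 1" and neg: "norm (1 - e) \<le> 1"
  shows "e = 0"
proof -
  define g where "g = \<i> *\<^sub>C e"
  have ii: "g * g = - (e * e)"
  proof -
    have "g * g = (- 1) *\<^sub>C (e * e)"
      by (simp add: g_def mult_scaleC_left mult_scaleC_right scaleC_scaleC)
    also have "\<dots> = - (e * e)"
      using scaleR_scaleC[of "- 1" "e * e"] by simp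
    finally show ?thesis .
  qed
  have gs: "g\<^sup>\<star> = - g"
    using scaleC_add_left[of "- \<i>" "\<i>" e]
    by (simp add: g_def star_scaleC sa eq_neg_iff_add_eq_0)
  have "norm ((1 + e) * (1 + e) + (1 - e) * (1 - e)) \<le> 1 * 1 + 1 * 1"
    by (intro norm_triangle_le add_mono norm_mult_le pos neg)
  also have "(1 + e) * (1 + e) + (1 - e) * (1 - e) = 2 *\<^sub>R (1 + e * e)"
    by (simp add: algebra_simps scaleR_2)
  finally have sq: "norm (1 + e * e) \<le> 1" by simp
  have contr: "norm (1 + h) \<le> 1" if "h = g \<or> h = - g" for h
  proof -
    have "h\<^sup>\<star> = - h" "h * h = - (e * e)" using that gs ii by (auto simp: star_minus)
    then have "(1 + h)\<^sup>\<star> * (1 + h) = 1 + e * e" by (simp add: star_add algebra_simps)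
    then have "(norm (1 + h))\<^sup>2 \<le> 1\<^sup>2" using cstar_identity[of "1 + h"] sq by simp
    then show ?thesis by (rule power2_le_imp_le) simp
  qed
  \<comment> \<open>The circle of radius 1/2 lies inside the square with vertices 1, \<i>, -1,
    -\<i>, which is why \<open>e\<close> is halved.\<close>
  have "(1 / 2) *\<^sub>R e = 0"
  proof (rule eq_0_if_norm_1_plus_circle_le_1)
    fix \<omega> :: complex assume "cmod \<omega> = 1"
    define x y where "x = Re \<omega> / 2" and "y = Im \<omega> / 2"
    have xy: "\<bar>x\<bar> + \<bar>y\<bar> \<le> 1"
      using abs_Re_le_cmod[of \<omega>] abs_Im_le_cmod[of \<omega>] \<open>cmod \<omega> = 1\<close> by (simp add: x_def y_def)
    have \<omega>: "\<omega> * complex_of_real (1 / 2) = complex_of_real x + complex_of_real y * \<i>"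
      by (simp add: complex_eq_iff x_def y_def)
    have "\<omega> *\<^sub>C ((1 / 2) *\<^sub>R e) = x *\<^sub>R e + y *\<^sub>R g"
      unfolding g_def scaleR_scaleC scaleC_scaleC \<omega> by (rule scaleC_add_left)
    also have "\<dots> = \<bar>x\<bar> *\<^sub>R (sgn x *\<^sub>R e) + \<bar>y\<bar> *\<^sub>R (sgn y *\<^sub>R g)"
      by (simp add: abs_mult_sgn)
    finally have "1 + \<omega> *\<^sub>C ((1 / 2) *\<^sub>R e) = (1 - \<bar>x\<bar> - \<bar>y\<bar>) *\<^sub>R 1
        + \<bar>x\<bar> *\<^sub>R (1 + sgn x *\<^sub>R e) + \<bar>y\<bar> *\<^sub>R (1 + sgn y *\<^sub>R g)"
      by (simp add: algebra_simps)
    moreover have "norm (1 + sgn x *\<^sub>R e) \<le> 1" "norm (1 + sgn y *\<^sub>R g) \<le> 1"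
      using pos neg contr[of g] contr[of "- g"] by (auto simp: sgn_if)
    moreover have "norm (a *\<^sub>R 1 + b *\<^sub>R u + c *\<^sub>R v) \<le> a + b * 1 + c * 1"
      if "a \<ge> 0" "b \<ge> 0" "c \<ge> 0" "norm u \<le> 1" "norm v \<le> 1" for a b c and u v :: 'a
    proof (intro norm_triangle_le[of "a *\<^sub>R 1 + b *\<^sub>R u"] add_mono norm_triangle_le[of "a *\<^sub>R 1"])
      show "norm (b *\<^sub>R u) \<le> b * 1" "norm (c *\<^sub>R v) \<le> c * 1"
        using that by (simp_all add: mult_left_le)
    qed (use that in simp)
    ultimately have "norm (1 + \<omega> *\<^sub>C ((1 / 2) *\<^sub>R e))
        \<le> (1 - \<bar>x\<bar> - \<bar>y\<bar>) + \<bar>x\<bar> * 1 + \<bar>y\<bar> * 1"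
      using xy by (metis (no_types, lifting) abs_ge_zero diff_diff_eq diff_ge_0_iff_ge)
    then show "norm (1 + \<omega> *\<^sub>C ((1 / 2) *\<^sub>R e)) \<le> 1" by simp
  qed
  then show ?thesis by simp
qed

locale cuntz_isometries =
  fixes n :: nat and s :: "nat \<Rightarrow> 'a::unital_cstar_algebra"
  assumes isom: "i \<in> {1..n} \<Longrightarrow> isometry (s i)"
    and sum_ranges: "(\<Sum>i=1..n. s i * (s i)\<^sup>\<star>) = 1"
begin

lemma star_mult_self: "i \<in> {1..n} \<Longrightarrow> (s i)\<^sup>\<star> * s i = 1"
  using isom by (simp add: isometry_def)

text \<open>Compressing the sum of the range projections by \<open>s i\<close> gives elements
  \<open>c j\<close> with sum 1 and \<open>c i = 1\<close>, so the others add up to 0. Being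
  positive, they should vanish; in place of the order, the argument uses that each
  \<open>1 - c j\<close> is a contraction.\<close>

lemma orthogonal_ranges:
  assumes i: "i \<in> {1..n}" and k: "k \<in> {1..n}" and "i \<noteq> k"
  shows "(s i)\<^sup>\<star> * s k = 0"
proof -
  define c where "c j = (s i)\<^sup>\<star> * (s j * (s j)\<^sup>\<star>) * s i" for j
  have ni: "norm (s i) = 1" using isom[OF i] by (rule norm_isometry)
  have one_minus: "1 - c j = (s i)\<^sup>\<star> * (1 - s j * (s j)\<^sup>\<star>) * s i" for j
    using star_mult_self[OF i] by (simp add: c_def algebra_simps)
  have near: "norm (1 - c j) \<le> 1" if "j \<in> {1..n}" for j
  proof -
    have "norm (1 - c j) \<le> (1 * 1) * 1" unfolding one_minus
      by (intro norm_mult_le norm_complement_range_le_1 isom that) (simp_all add: norm_star ni)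
    then show ?thesis by simp
  qed
  have "(\<Sum>j=1..n. c j) = (s i)\<^sup>\<star> * (\<Sum>j=1..n. s j * (s j)\<^sup>\<star>) * s i"
    unfolding c_def by (simp only: sum_distrib_left sum_distrib_right)
  then have total: "(\<Sum>j=1..n. c j) = 1"
    by (simp only: sum_ranges star_mult_self[OF i] mult_1_right)
  have "c i = ((s i)\<^sup>\<star> * s i) * ((s i)\<^sup>\<star> * s i)" by (simp only: c_def mult.assoc)
  then have "c i = 1" by (simp add: star_mult_self[OF i])
  define B where "B = {1..n} - {i} - {k}"
  have "(\<Sum>j=1..n. c j) = c i + (c k + (\<Sum>j\<in>B. c j))"
    using i k \<open>i \<noteq> k\<close> unfolding B_def
    by (subst sum.remove[of _ i], simp_all, subst sum.remove[of _ k], simp_all)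
  then have ck: "c k = - (\<Sum>j\<in>B. c j)" using total \<open>c i = 1\<close> by (simp add: eq_neg_iff_add_eq_0)
  \<comment> \<open>A scale that serves both signs: \<open>t + c k\<close> is 1 plus a sum of
    \<open>card B\<close> contractions, and \<open>t \<ge> 1\<close> makes
    \<open>1 - c k / t\<close> a convex combination of 1 and \<open>1 - c k\<close>. The summand 1
    keeps \<open>t\<close> positive when \<open>B\<close> is empty, as for
    \<open>n = 2\<close>.\<close>
  define t where "t = 1 + real (card B)"
  have t: "t \<ge> 1" by (simp add: t_def)
  have "norm (of_nat (card B) + c k) = norm (\<Sum>j\<in>B. 1 - c j)"
    by (simp add: ck sum_subtractf)
  also have "\<dots> \<le> (\<Sum>j\<in>B. 1)" by (intro sum_norm_le near) (auto simp: B_def)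
  finally have "norm (of_nat (card B) + c k) \<le> card B" by simp
  then have "norm (1 + (of_nat (card B) + c k)) \<le> 1 + real (card B)"
    by (intro norm_triangle_le) simp
  moreover have "t *\<^sub>R (1 + (1 / t) *\<^sub>R c k) = 1 + (of_nat (card B) + c k)"
    using t by (simp add: scaleR_add_right) (simp add: t_def scaleR_conv_of_real)
  ultimately have "t * norm (1 + (1 / t) *\<^sub>R c k) \<le> t * 1"
    using t by (metis abs_of_nonneg mult.right_neutral norm_scaleR order_trans t_def zero_le_one)
  then have up: "norm (1 + (1 / t) *\<^sub>R c k) \<le> 1" using t by simp
  have "1 - (1 / t) *\<^sub>R c k = (1 - 1 / t) *\<^sub>R 1 + (1 / t) *\<^sub>R (1 - c k)"
    by (simp add: algebra_simps)
  moreover have "norm \<dots> \<le> (1 - 1 / t) * 1 + (1 / t) * 1"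
    using t near[OF k] by (auto intro!: norm_triangle_le add_mono mult_left_mono simp: divide_le_eq)
  ultimately have down: "norm (1 - (1 / t) *\<^sub>R c k) \<le> 1" by simp
  have "(c k)\<^sup>\<star> = c k" by (simp add: c_def star_mult star_star mult.assoc)
  then have "(1 / t) *\<^sub>R c k = 0"
    by (intro self_adjoint_eq_0_if_norm_1_pm_le_1 up down) (simp add: star_scaleR)
  then have "c k = 0" using t by simp
  \<comment> \<open>\<open>c k\<close> has the form to which the C*-identity applies.\<close>
  then have "((s k)\<^sup>\<star> * s i)\<^sup>\<star> * ((s k)\<^sup>\<star> * s i) = 0"
    by (simp add: c_def star_mult star_star mult.assoc)
  then have "(s k)\<^sup>\<star> * s i = 0" using cstar_identity[of "(s k)\<^sup>\<star> * s i"] by simp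
  then show ?thesis by (metis star_0 star_mult star_star)
qed

lemma star_mult_generators:
  "i \<in> {1..n} \<Longrightarrow> k \<in> {1..n} \<Longrightarrow> (s i)\<^sup>\<star> * s k = (if i = k then 1 else 0)"
  by (simp add: orthogonal_ranges star_mult_self)

subsection \<open>The canonical endomorphism\<close>

definition endo :: "'a \<Rightarrow> 'a" where
  "endo x = (\<Sum>i=1..n. s i * x * (s i)\<^sup>\<star>)"

text \<open>Orthogonality leaves a single summand. Together with \<open>endo_mult_generator\<close>
  this intertwining drives all later computations: moving a generator past a power of
  \<open>endo\<close> changes the exponent by one.\<close>

lemma star_mult_endo:
  assumes "i \<in> {1..n}" shows "(s i)\<^sup>\<star> * endo x = x * (s i)\<^sup>\<star>"
proof -
  have "(s i)\<^sup>\<star> * endo x = (\<Sum>k=1..n. ((s i)\<^sup>\<star> * s k) * (x * (s k)\<^sup>\<star>))"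
    unfolding endo_def sum_distrib_left by (simp only: mult.assoc)
  also have "\<dots> = (\<Sum>k=1..n. if i = k then x * (s k)\<^sup>\<star> else 0)"
    by (intro sum.cong refl) (simp add: star_mult_generators[OF assms] star_mult_generators[OF _ assms])
  finally show ?thesis using assms by simp
qed

lemma endo_mult_generator:
  assumes "i \<in> {1..n}" shows "endo x * s i = s i * x"
proof -
  have "endo x * s i = (\<Sum>k=1..n. (s k * x) * ((s k)\<^sup>\<star> * s i))"
    unfolding endo_def sum_distrib_right by (simp only: mult.assoc)
  also have "\<dots> = (\<Sum>k=1..n. if k = i then s k * x else 0)"
    by (intro sum.cong refl) (simp add: star_mult_generators[OF assms] star_mult_generators[OF _ assms])
  finally show ?thesis using assms by simp
qed

lemma endo_0: "endo 0 = 0"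
  by (simp add: endo_def)

lemma endo_1: "endo 1 = 1"
  using sum_ranges by (simp add: endo_def)

lemma endo_star: "endo (x\<^sup>\<star>) = (endo x)\<^sup>\<star>"
  by (simp add: endo_def star_sum star_mult star_star mult.assoc)

lemma endo_mult: "endo (x * y) = endo x * endo y"
proof -
  have "endo x * endo y = (\<Sum>i=1..n. s i * x * ((s i)\<^sup>\<star> * endo y))"
    unfolding endo_def[of x] sum_distrib_right by (simp only: mult.assoc)
  also have "\<dots> = (\<Sum>i=1..n. s i * (x * y) * (s i)\<^sup>\<star>)"
    by (intro sum.cong refl) (simp add: star_mult_endo mult.assoc)
  finally show ?thesis by (simp add: endo_def)
qed

lemma endo_pow_0: "(endo ^^ j) 0 = 0" and endo_pow_1: "(endo ^^ j) 1 = 1"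
  by (induction j) (simp_all add: endo_0 endo_1)

lemma endo_pow_star: "(endo ^^ j) (x\<^sup>\<star>) = ((endo ^^ j) x)\<^sup>\<star>"
  by (induction j) (simp_all add: endo_star)

lemma endo_pow_mult: "(endo ^^ j) (x * y) = (endo ^^ j) x * (endo ^^ j) y"
  by (induction j) (simp_all add: endo_mult)

lemma isometry_endo_pow: "isometry u \<Longrightarrow> isometry ((endo ^^ j) u)"
  by (simp add: isometry_def endo_pow_1 flip: endo_pow_star endo_pow_mult)

lemma endo_pow_mult_power:
  assumes "i \<in> {1..n}" shows "(endo ^^ j) x * s i ^ j = s i ^ j * x"
proof (induction j)
  case (Suc j)
  have "(endo ^^ Suc j) x * s i ^ Suc j = (endo ((endo ^^ j) x) * s i) * s i ^ j"
    by (simp add: mult.assoc)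
  also have "\<dots> = s i * ((endo ^^ j) x * s i ^ j)"
    by (simp only: endo_mult_generator[OF assms] mult.assoc)
  also have "\<dots> = s i ^ Suc j * x" by (simp only: Suc power_Suc mult.assoc)
  finally show ?case .
qed simp

lemma star_power_mult_endo_pow:
  assumes "i \<in> {1..n}" shows "((s i)\<^sup>\<star>) ^ j * (endo ^^ j) x = x * ((s i)\<^sup>\<star>) ^ j"
proof (induction j)
  case (Suc j)
  have "((s i)\<^sup>\<star>) ^ Suc j * (endo ^^ Suc j) x = ((s i)\<^sup>\<star>) ^ j * ((s i)\<^sup>\<star> * endo ((endo ^^ j) x))"
    by (simp only: power_Suc2 funpow.simps comp_apply mult.assoc)
  also have "\<dots> = (((s i)\<^sup>\<star>) ^ j * (endo ^^ j) x) * (s i)\<^sup>\<star>"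
    by (simp only: star_mult_endo[OF assms] mult.assoc)
  also have "\<dots> = x * ((s i)\<^sup>\<star>) ^ Suc j"
    by (simp only: Suc power_Suc2 mult.assoc)
  finally show ?case .
qed simp

end

subsection \<open>Asymptotically central isometries\<close>

locale cuntz_generators = cuntz_isometries n s
  for n and s :: "nat \<Rightarrow> 'a::unital_cstar_algebra" +
  assumes n_ge_2: "n \<ge> 2" and generates: "cstar_generated (s ` {1..n}) = UNIV"
begin

text \<open>The \<open>u\<close> of the overview. The factor \<open>s 1\<close> has range orthogonal
  to that of \<open>s n\<close>, and the exponent \<open>L\<close> makes the images under up to
  \<open>L\<close> steps of \<open>endo\<close> orthogonal to the original.\<close>

definition seed :: "nat \<Rightarrow> 'a" where
  "seed L = s n ^ L * s 1"

text \<open>The \<open>V\<close> of the overview. For \<open>L = 0\<close> the sum is empty and the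
  value is 0, so it is an isometry only for positive \<open>L\<close>.\<close>

definition spread :: "nat \<Rightarrow> 'a" where
  "spread L = (1 / sqrt (real L)) *\<^sub>R (\<Sum>j<L. (endo ^^ j) (seed L))"

lemma n_in: "n \<in> {1..n}" and one_in: "1 \<in> {1..n}"
  using n_ge_2 by auto

lemma isometry_seed: "isometry (seed L)"
  unfolding seed_def by (intro isometry_mult isometry_power isom n_in one_in)

text \<open>Since \<open>n \<ge> 2\<close>, \<open>s 1\<close> and \<open>s n\<close> are distinct
  generators, and the adjoint standing next to \<open>s 1\<close> annihilates it.\<close>

lemma star_power_mult_first:
  assumes "k > 0" shows "((s n)\<^sup>\<star>) ^ k * s 1 = 0"
proof -
  obtain m where "k = Suc m" using assms gr0_implies_Suc by blast
  then have "((s n)\<^sup>\<star>) ^ k * s 1 = ((s n)\<^sup>\<star>) ^ m * ((s n)\<^sup>\<star> * s 1)"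
    by (simp only: power_Suc2 mult.assoc)
  then show ?thesis using orthogonal_ranges[OF n_in one_in] n_ge_2 by simp
qed

lemma star_first_mult_power: "k > 0 \<Longrightarrow> (s 1)\<^sup>\<star> * s n ^ k = 0"
  using star_power_mult_first[of k] by (metis star_0 star_mult star_power star_star)

text \<open>As \<open>r \<le> L\<close>, the adjoint of the seed supplies \<open>r\<close> adjoints
  of \<open>s n\<close> to strip off \<open>endo ^^ r\<close>. After cancellation the adjoint of
  \<open>s 1\<close> meets \<open>s n ^ r\<close>, which gives 0.\<close>

lemma seed_star_mult_endo_pow:
  assumes "0 < r" "r \<le> L" shows "(seed L)\<^sup>\<star> * (endo ^^ r) (seed L) = 0"
proof -
  obtain m where m: "L = m + r" using assms(2) by (metis le_add_diff_inverse2)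
  have "(seed L)\<^sup>\<star> * (endo ^^ r) (seed L)
      = (s 1)\<^sup>\<star> * ((s n)\<^sup>\<star>) ^ m * (((s n)\<^sup>\<star>) ^ r * (endo ^^ r) (seed L))"
    by (subst seed_def) (simp only: star_mult star_power, simp only: m power_add mult.assoc)
  also have "\<dots> = (s 1)\<^sup>\<star> * (((s n)\<^sup>\<star>) ^ m * s n ^ (m + r)) * (s 1 * ((s n)\<^sup>\<star>) ^ r)"
    by (simp only: star_power_mult_endo_pow[OF n_in]) (simp only: seed_def m mult.assoc)
  also have "\<dots> = 0"
    by (simp add: isometry_cancel_powers[OF isom[OF n_in]] star_first_mult_power assms
        del: One_nat_def)
  finally show ?thesis .
qed

lemma spread_terms_orthogonal_less:
  assumes "j < k" "k < L"
  shows "((endo ^^ j) (seed L))\<^sup>\<star> * (endo ^^ k) (seed L) = 0"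
proof -
  have "(endo ^^ k) (seed L) = (endo ^^ j) ((endo ^^ (k - j)) (seed L))"
    using assms by (metis comp_apply funpow_add le_add_diff_inverse less_imp_le)
  then have "((endo ^^ j) (seed L))\<^sup>\<star> * (endo ^^ k) (seed L)
      = (endo ^^ j) ((seed L)\<^sup>\<star> * (endo ^^ (k - j)) (seed L))"
    by (simp add: endo_pow_mult endo_pow_star)
  then show ?thesis using assms by (simp add: seed_star_mult_endo_pow endo_pow_0)
qed

lemma spread_terms_orthogonal:
  assumes "j \<noteq> k" "j < L" "k < L"
  shows "((endo ^^ j) (seed L))\<^sup>\<star> * (endo ^^ k) (seed L) = 0"
proof (cases "j < k")
  case False
  then have "((endo ^^ k) (seed L))\<^sup>\<star> * (endo ^^ j) (seed L) = 0"
    using assms by (intro spread_terms_orthogonal_less) auto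
  then show ?thesis by (metis star_0 star_mult star_star)
qed (use assms spread_terms_orthogonal_less in blast)

lemma isometry_spread:
  assumes "L > 0" shows "isometry (spread L)"
proof -
  let ?w = "\<lambda>j. (endo ^^ j) (seed L)"
  have "(\<Sum>j<L. ?w j)\<^sup>\<star> * (\<Sum>k<L. ?w k) = (\<Sum>j<L. \<Sum>k<L. (?w j)\<^sup>\<star> * ?w k)"
    by (simp add: star_sum sum_product)
  also have "\<dots> = (\<Sum>j<L. \<Sum>k<L. if j = k then 1 else 0)"
    using isometry_endo_pow[OF isometry_seed]
    by (intro sum.cong refl) (auto simp: spread_terms_orthogonal isometry_def)
  also have "\<dots> = real L *\<^sub>R 1" by (simp add: scaleR_conv_of_real)
  finally have "(spread L)\<^sup>\<star> * spread L
      = (1 / sqrt (real L) * (1 / sqrt (real L)) * real L) *\<^sub>R 1"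
    by (simp add: spread_def star_scaleR)
  then show ?thesis using assms by (simp add: isometry_def)
qed

text \<open>Multiplied by \<open>s n ^ j\<close>, the \<open>j\<close>-th term becomes
  \<open>s n ^ (j + L) * s 1\<close>. Since \<open>j + L < 2 * L\<close>, adjoints of
  \<open>s n\<close> are left over and kill \<open>s 1\<close>.\<close>

lemma spread_corner:
  "((s n)\<^sup>\<star>) ^ (2 * L) * spread L * s n ^ (2 * L) = 0"
proof -
  have "((s n)\<^sup>\<star>) ^ (2 * L) * (endo ^^ j) (seed L) * s n ^ (2 * L) = 0" if "j < L" for j
  proof -
    obtain m where "L = j + m" and "m > 0"
      using less_imp_add_positive[OF \<open>j < L\<close>] by auto
    \<comment> \<open>The first splitting is for the left power, where \<open>m\<close> adjoints
      survive the cancellation; the second gives up \<open>s n ^ j\<close> on the right to strip off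
      \<open>endo ^^ j\<close>.\<close>
    then have m: "2 * L = m + (j + L)" "2 * L = j + (m + L)" by simp_all
    have "((s n)\<^sup>\<star>) ^ (2 * L) * (endo ^^ j) (seed L) * s n ^ (2 * L)
        = ((s n)\<^sup>\<star>) ^ (2 * L) * ((endo ^^ j) (seed L) * s n ^ j) * s n ^ (m + L)"
      by (simp only: mult.assoc flip: power_add) (simp only: m(2))
    also have "\<dots> = (((s n)\<^sup>\<star>) ^ (m + (j + L)) * s n ^ (j + L)) * s 1 * s n ^ (m + L)"
      by (simp only: endo_pow_mult_power[OF n_in] m(1)) (simp add: seed_def power_add mult.assoc)
    also have "\<dots> = 0"
      by (simp only: isometry_cancel_star_powers[OF isom[OF n_in]] star_power_mult_first[OF \<open>m > 0\<close>]
          mult_zero_left)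
    finally show ?thesis .
  qed
  then show ?thesis by (simp add: spread_def sum_distrib_left sum_distrib_right)
qed

lemma endo_pow_telescope:
  "(\<Sum>j<L. (endo ^^ j) u) - (\<Sum>j<L. (endo ^^ Suc j) u) = u - (endo ^^ L) u"
  by (induction L) (simp_all add: algebra_simps)

lemma norm_telescoped_seed: "norm (seed L - (endo ^^ L) (seed L)) \<le> 2"
proof -
  have "norm (seed L) = 1" "norm ((endo ^^ L) (seed L)) = 1"
    by (intro norm_isometry isometry_endo_pow isometry_seed)+
  then show ?thesis using norm_triangle_ineq4[of "seed L" "(endo ^^ L) (seed L)"] by simp
qed

text \<open>Moving \<open>s i\<close> through the sum shifts every exponent by one, so only the two
  end terms survive, each an isometry weighted by \<open>1 / sqrt L\<close>.\<close>

lemma norm_commutator_spread_generator: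
  assumes i: "i \<in> {1..n}"
  shows "norm (spread L * s i - s i * spread L) \<le> 2 / sqrt (real L)"
proof -
  let ?d = "seed L - (endo ^^ L) (seed L)"
  have "s i * (\<Sum>j<L. (endo ^^ j) (seed L)) = (\<Sum>j<L. (endo ^^ Suc j) (seed L)) * s i"
    by (simp add: sum_distrib_left sum_distrib_right endo_mult_generator[OF i])
  then have "spread L * s i - s i * spread L = (1 / sqrt (real L)) *\<^sub>R
      (((\<Sum>j<L. (endo ^^ j) (seed L)) - (\<Sum>j<L. (endo ^^ Suc j) (seed L))) * s i)"
    by (simp add: spread_def left_diff_distrib scaleR_diff_right)
  then have "norm (spread L * s i - s i * spread L) = 1 / sqrt (real L) * norm (?d * s i)"
    by (simp only: endo_pow_telescope) simp
  also have "\<dots> \<le> 1 / sqrt (real L) * (2 * 1)"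
    by (intro mult_left_mono norm_mult_le norm_telescoped_seed)
      (simp_all add: norm_isometry isom[OF i])
  finally show ?thesis by simp
qed

text \<open>Taking adjoints in the bound for generators would give a statement about the adjoint of
  \<open>spread L\<close>; the telescoping is therefore repeated with
  \<open>star_mult_endo\<close>.\<close>

lemma norm_commutator_spread_star:
  assumes i: "i \<in> {1..n}"
  shows "norm (spread L * (s i)\<^sup>\<star> - (s i)\<^sup>\<star> * spread L) \<le> 2 / sqrt (real L)"
proof -
  let ?d = "seed L - (endo ^^ L) (seed L)"
  have "(\<Sum>j<L. (endo ^^ j) (seed L)) * (s i)\<^sup>\<star> = (s i)\<^sup>\<star> * (\<Sum>j<L. (endo ^^ Suc j) (seed L))"
    by (simp add: sum_distrib_left sum_distrib_right star_mult_endo[OF i])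
  then have "(s i)\<^sup>\<star> * spread L - spread L * (s i)\<^sup>\<star> = (1 / sqrt (real L)) *\<^sub>R
      ((s i)\<^sup>\<star> * ((\<Sum>j<L. (endo ^^ j) (seed L)) - (\<Sum>j<L. (endo ^^ Suc j) (seed L))))"
    by (simp add: spread_def right_diff_distrib scaleR_diff_right)
  then have "norm ((s i)\<^sup>\<star> * spread L - spread L * (s i)\<^sup>\<star>)
      = 1 / sqrt (real L) * norm ((s i)\<^sup>\<star> * ?d)"
    by (simp only: endo_pow_telescope) simp
  also have "\<dots> \<le> 1 / sqrt (real L) * (1 * 2)"
    by (intro mult_left_mono norm_mult_le norm_telescoped_seed)
      (simp_all add: norm_star norm_isometry isom[OF i])
  finally show ?thesis by (simp add: norm_minus_commute)
qed

lemma norm_spread_le_1: "norm (spread L) \<le> 1"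
  using norm_isometry[OF isometry_spread] by (cases "L = 0") (auto simp: spread_def)

definition asymptotic_commutant :: "'a set" where
  "asymptotic_commutant = {x. (\<lambda>L. spread L * x - x * spread L) \<longlonglongrightarrow> 0}"

lemma in_asymptotic_commutantI:
  assumes "\<And>L. norm (spread L * x - x * spread L) \<le> 2 / sqrt (real L)"
  shows "x \<in> asymptotic_commutant"
proof -
  have "(\<lambda>L. 2 / sqrt (real L)) \<longlonglongrightarrow> 0"
    by (intro tendsto_divide_0[OF tendsto_const] filterlim_at_top_imp_at_infinity
        filterlim_compose[OF sqrt_at_top filterlim_real_sequentially])
  then show ?thesis unfolding asymptotic_commutant_def
    by (auto intro!: Lim_null_comparison[where g = "\<lambda>L. 2 / sqrt (real L)"] always_eventually assms)
qed

lemma asymptotic_commutant_add: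
  assumes "x \<in> asymptotic_commutant" "y \<in> asymptotic_commutant"
  shows "x + y \<in> asymptotic_commutant"
proof -
  have "(\<lambda>L. (spread L * x - x * spread L) + (spread L * y - y * spread L)) \<longlonglongrightarrow> 0 + 0"
    using assms unfolding asymptotic_commutant_def by (intro tendsto_add) auto
  then show ?thesis by (simp add: asymptotic_commutant_def algebra_simps)
qed

lemma asymptotic_commutant_mult:
  assumes "x \<in> asymptotic_commutant" "y \<in> asymptotic_commutant"
  shows "x * y \<in> asymptotic_commutant"
proof -
  have "(\<lambda>L. (spread L * x - x * spread L) * y + x * (spread L * y - y * spread L))
      \<longlonglongrightarrow> 0 * y + x * 0"
    using assms unfolding asymptotic_commutant_def by (intro tendsto_intros) auto
  then show ?thesis by (simp add: asymptotic_commutant_def algebra_simps)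
qed

lemma asymptotic_commutant_scaleC:
  assumes "x \<in> asymptotic_commutant"
  shows "c *\<^sub>C x \<in> asymptotic_commutant"
proof -
  have "(\<lambda>L. cmod c * norm (spread L * x - x * spread L)) \<longlonglongrightarrow> 0"
    using assms unfolding asymptotic_commutant_def
    by (auto intro!: tendsto_mult_right_zero tendsto_norm_zero)
  then have "(\<lambda>L. norm (spread L * (c *\<^sub>C x) - (c *\<^sub>C x) * spread L)) \<longlonglongrightarrow> 0"
    by (simp add: mult_scaleC_left mult_scaleC_right flip: scaleC_diff_right norm_scaleC)
  then show ?thesis
    by (simp add: asymptotic_commutant_def tendsto_norm_zero_iff)
qed

text \<open>The bound \<open>norm_spread_le_1\<close> makes the commutator continuous in
  \<open>x\<close> uniformly in \<open>L\<close>, so limits of sequences stay in the set.\<close>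

lemma closed_asymptotic_commutant: "closed asymptotic_commutant"
  unfolding closed_sequential_limits
proof (intro allI impI)
  fix X x assume "(\<forall>m. X m \<in> asymptotic_commutant) \<and> X \<longlonglongrightarrow> x"
  then have X: "\<And>m. X m \<in> asymptotic_commutant" and lim: "X \<longlonglongrightarrow> x" by auto
  have "(\<lambda>L. spread L * x - x * spread L) \<longlonglongrightarrow> 0"
  proof (rule LIMSEQ_I)
    fix r :: real assume "r > 0"
    then obtain m where m: "norm (x - X m) < r / 4"
      using LIMSEQ_D[OF lim, of "r / 4"] by (auto simp: norm_minus_commute)
    obtain L0 where L0: "\<And>L. L \<ge> L0 \<Longrightarrow> norm (spread L * X m - X m * spread L) < r / 2"
      using LIMSEQ_D[of _ 0 "r / 2"] X[of m] \<open>r > 0\<close> unfolding asymptotic_commutant_def by auto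
    show "\<exists>L0. \<forall>L\<ge>L0. norm (spread L * x - x * spread L - 0) < r"
    proof (intro exI allI impI)
      fix L assume "L0 \<le> L"
      have "norm (spread L * (x - X m)) \<le> 1 * (r / 4)" "norm ((x - X m) * spread L) \<le> (r / 4) * 1"
        by (intro norm_mult_le norm_spread_le_1 less_imp_le[OF m])+
      then have "norm (spread L * (x - X m)) + norm ((x - X m) * spread L)
          + norm (spread L * X m - X m * spread L) < r"
        using L0[OF \<open>L0 \<le> L\<close>] by simp
      moreover have "spread L * x - x * spread L = spread L * (x - X m) - (x - X m) * spread L
          + (spread L * X m - X m * spread L)" by (simp add: algebra_simps)
      moreover have "norm (a - b + c) \<le> norm a + norm b + norm c" for a b c :: 'a
        by (meson add_right_mono norm_triangle_ineq norm_triangle_ineq4 order_trans)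
      ultimately show "norm (spread L * x - x * spread L - 0) < r"
        unfolding diff_zero by (metis order_le_less_trans)
    qed
  qed
  then show "x \<in> asymptotic_commutant" by (simp add: asymptotic_commutant_def)
qed

lemma spread_asymptotically_central:
  "(\<lambda>L. spread L * x - x * spread L) \<longlonglongrightarrow> 0"
proof -
  \<comment> \<open>\<open>asymptotic_commutant\<close> is not visibly closed under adjoints;
    imposing the condition on \<open>x\<close> and on its adjoint yields a C*-subalgebra.\<close>
  define B where "B = {x. x \<in> asymptotic_commutant \<and> x\<^sup>\<star> \<in> asymptotic_commutant}"
  have star_cont: "continuous_on UNIV (star :: 'a \<Rightarrow> 'a)"
    by (rule continuous_onI) (metis dist_norm norm_star star_diff order_less_imp_le)
  have "B = asymptotic_commutant \<inter> star -` asymptotic_commutant" by (auto simp: B_def)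
  then have "closed B"
    using closed_asymptotic_commutant continuous_on_closed_vimage[of UNIV star] star_cont
    by (auto intro!: closed_Int)
  moreover have "0 \<in> asymptotic_commutant" by (simp add: asymptotic_commutant_def)
  ultimately have "cstar_subalgebra B"
    unfolding cstar_subalgebra_def
    by (auto simp: B_def star_add star_mult star_star star_scaleC asymptotic_commutant_add
        asymptotic_commutant_mult asymptotic_commutant_scaleC)
  moreover have "s ` {1..n} \<subseteq> B"
  proof clarify
    fix i assume "i \<in> {1..n}"
    then show "s i \<in> B" unfolding B_def
      by (intro CollectI conjI in_asymptotic_commutantI norm_commutator_spread_generator
          norm_commutator_spread_star)
  qed
  ultimately have "cstar_generated (s ` {1..n}) \<subseteq> B"
    unfolding cstar_generated_def by (intro hull_minimal)
  then have "x \<in> B" using generates by blast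
  then show ?thesis by (simp add: B_def asymptotic_commutant_def)
qed

section \<open>The projections onto the ranges of the powers of \<open>s n\<close>, and the elements
  they absorb\<close>

definition tail :: "nat \<Rightarrow> 'a" where
  "tail K = s n ^ K * ((s n)\<^sup>\<star>) ^ K"

lemma norm_tail_le_1: "norm (tail K) \<le> 1"
proof -
  have "norm (s n ^ K) = 1" by (intro norm_isometry isometry_power isom n_in)
  then have "norm (tail K) \<le> 1 * 1" unfolding tail_def
    by (intro norm_mult_le) (simp_all add: norm_star flip: star_power)
  then show ?thesis by simp
qed

lemma tail_star: "(tail K)\<^sup>\<star> = tail K"
  by (simp add: tail_def star_mult star_power star_star)

text \<open>
  The isometry \<open>spread L\<close> almost commutes with \<open>y\<close>, yet it moves the range of
  \<open>tail (2 * L)\<close>, which contains that of \<open>y\<close>, into its orthogonal complement.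
\<close>

lemma eq_0_if_tail_absorbs:
  assumes "\<And>K. tail K * y = y" shows "y = 0"
proof -
  let ?c = "\<lambda>L. norm (spread L * y - y * spread L)"
  have bound: "norm y \<le> 2 * ?c L" if "L > 0" for L
  proof -
    have "tail (2 * L) * spread L * y = tail (2 * L) * spread L * (tail (2 * L) * y)"
      by (simp add: assms)
    also have "\<dots> = s n ^ (2 * L) * (((s n)\<^sup>\<star>) ^ (2 * L) * spread L * s n ^ (2 * L))
        * (((s n)\<^sup>\<star>) ^ (2 * L) * y)"
      by (simp only: tail_def mult.assoc)
    finally have corner: "tail (2 * L) * spread L * y = 0" by (simp add: spread_corner)
    \<comment> \<open>Absorption inserts the projection in front, and \<open>corner\<close> lets
      \<open>spread L * y\<close> be subtracted for free, leaving a commutator.\<close>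
    have "y * spread L = tail (2 * L) * (y * spread L)" by (simp add: assms flip: mult.assoc)
    also have "\<dots> = - (tail (2 * L) * (spread L * y - y * spread L))"
      using corner by (simp add: algebra_simps)
    finally have "norm (y * spread L) = norm (tail (2 * L) * (spread L * y - y * spread L))"
      by (metis norm_minus_cancel)
    also have "\<dots> \<le> 1 * ?c L" by (intro norm_mult_le norm_tail_le_1 order_refl)
    finally have "norm (y * spread L) \<le> ?c L" by simp
    moreover have "norm y = norm (spread L * y)"
      using isometry_spread[OF that] by (simp add: norm_isometry_mult)
    moreover have "norm (spread L * y) \<le> ?c L + norm (y * spread L)"
      by (metis norm_triangle_sub add.commute)
    ultimately show ?thesis by simp
  qed
  have "(\<lambda>L. 2 * ?c L) \<longlonglongrightarrow> 2 * 0"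
    by (intro tendsto_mult tendsto_const tendsto_norm_zero spread_asymptotically_central)
  then have "norm y \<le> 2 * 0"
    by (rule tendsto_lowerbound) (auto intro!: eventually_sequentiallyI[of 1] bound)
  then show ?thesis by simp
qed

lemma eq_0_if_tail_complements_kill:
  assumes "\<And>K L. (1 - tail K) * x * (1 - tail L) = 0" shows "x = 0"
proof -
  have "x * (1 - tail L) = 0" for L
  proof (rule eq_0_if_tail_absorbs)
    fix K show "tail K * (x * (1 - tail L)) = x * (1 - tail L)"
      using assms[of K L] by (simp add: left_diff_distrib mult.assoc)
  qed
  \<comment> \<open>The adjoint of \<open>x * (1 - tail L) = 0\<close> says that
    \<open>tail L\<close> absorbs the adjoint of \<open>x\<close>.\<close>
  then have "x\<^sup>\<star> = 0"
    by (intro eq_0_if_tail_absorbs)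
      (metis eq_iff_diff_eq_0 mult.right_neutral right_diff_distrib star_mult tail_star)
  then show ?thesis by (metis star_0 star_star)
qed

lemma last_range: "s n * (s n)\<^sup>\<star> + (\<Sum>i=1..n-1. s i * (s i)\<^sup>\<star>) = 1"
proof -
  have "{1..n} = insert n {1..n-1}" using n_ge_2 by auto
  then show ?thesis using sum_ranges n_ge_2 by simp
qed

text \<open>By \<open>last_range\<close>, the difference \<open>tail K - tail (Suc K)\<close> is the
  sum of the range projections of \<open>s n ^ K * s i\<close> with \<open>i < n\<close>, and these
  differences telescope. The summands are the range projections of the embedded family.\<close>

lemma tail_complement:
  "1 - tail K = (\<Sum>k<K. \<Sum>i=1..n-1. (s n ^ k * s i) * (s n ^ k * s i)\<^sup>\<star>)"
proof (induction K)
  case (Suc K)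
  have "(\<Sum>i=1..n-1. (s n ^ K * s i) * (s n ^ K * s i)\<^sup>\<star>)
      = s n ^ K * (\<Sum>i=1..n-1. s i * (s i)\<^sup>\<star>) * ((s n)\<^sup>\<star>) ^ K"
    by (simp only: sum_distrib_left sum_distrib_right star_mult star_power mult.assoc)
  also have "(\<Sum>i=1..n-1. s i * (s i)\<^sup>\<star>) = 1 - s n * (s n)\<^sup>\<star>"
    using last_range by (simp add: eq_diff_eq add.commute)
  also have "s n ^ K * \<dots> * ((s n)\<^sup>\<star>) ^ K = tail K - s n ^ K * (s n * (s n)\<^sup>\<star>) * ((s n)\<^sup>\<star>) ^ K"
    by (simp add: tail_def left_diff_distrib right_diff_distrib)
  also have "s n ^ K * (s n * (s n)\<^sup>\<star>) * ((s n)\<^sup>\<star>) ^ K = tail (Suc K)"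
    unfolding tail_def power_Suc2[of "s n"] by (simp only: power_Suc mult.assoc)
  finally have "(\<Sum>i=1..n-1. (s n ^ K * s i) * (s n ^ K * s i)\<^sup>\<star>) = tail K - tail (Suc K)" .
  then show ?case unfolding sum.lessThan_Suc Suc[symmetric] by simp
qed (simp add: tail_def)

end

subsection \<open>Images of Cuntz families\<close>

lemma unital_star_hom_sum:
  assumes "unital_star_hom f" shows "f (\<Sum>i\<in>A. g i) = (\<Sum>i\<in>A. f (g i))"
proof -
  have add: "f (x + y) = f x + f y" for x y using assms by (simp add: unital_star_hom_def)
  then have "f 0 = 0" using add[of 0 0] by simp
  then show ?thesis by (induction A rule: infinite_finite_induct) (simp_all add: add)
qed

lemma unital_star_hom_diff:
  assumes "unital_star_hom f" shows "f (x - y) = f x - f y"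
proof -
  have "f (x - y + y) = f (x - y) + f y" using assms unfolding unital_star_hom_def by blast
  then show ?thesis by simp
qed

text \<open>The image of an inverse of \<open>a - z *\<^sub>C 1\<close> inverts
  \<open>f a - z *\<^sub>C 1\<close>. As positivity is defined through the spectrum, this is what
  carries the order along \<open>f\<close>.\<close>

lemma unital_star_hom_spectrum:
  assumes "unital_star_hom f" shows "cstar_spectrum (f a) \<subseteq> cstar_spectrum a"
proof
  fix z assume z: "z \<in> cstar_spectrum (f a)"
  have f: "f 1 = 1" "\<And>x y. f (x * y) = f x * f y" "\<And>c x. f (c *\<^sub>C x) = c *\<^sub>C f x"
    using assms by (auto simp: unital_star_hom_def)
  then have d: "f (a - z *\<^sub>C 1) = f a - z *\<^sub>C 1" by (simp add: unital_star_hom_diff[OF assms])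
  show "z \<in> cstar_spectrum a"
    unfolding cstar_spectrum_def
  proof (intro CollectI notI, elim exE conjE)
    fix b assume "(a - z *\<^sub>C 1) * b = 1" "b * (a - z *\<^sub>C 1) = 1"
    then have "(f a - z *\<^sub>C 1) * f b = 1 \<and> f b * (f a - z *\<^sub>C 1) = 1"
      using f d by metis
    then show False using z unfolding cstar_spectrum_def by blast
  qed
qed

lemma unital_star_hom_le:
  assumes "unital_star_hom f" "a \<preceq> b" shows "f a \<preceq> f b"
proof -
  have "f ((b - a)\<^sup>\<star>) = (f (b - a))\<^sup>\<star>" using assms by (simp add: unital_star_hom_def)
  then show ?thesis
    using assms(2) unital_star_hom_spectrum[OF assms(1), of "b - a"]
    by (auto simp: cstar_le_def cstar_positive_def unital_star_hom_diff[OF assms(1)])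
qed

lemma unital_star_hom_cuntz_family:
  assumes f: "unital_star_hom f" and t: "cuntz_family t"
  shows "cuntz_family (\<lambda>i. f (t i))"
proof -
  have f1: "f 1 = 1" and fp: "f (x * y\<^sup>\<star>) = f x * (f y)\<^sup>\<star>" "f (x\<^sup>\<star> * y) = (f x)\<^sup>\<star> * f y" for x y
    using f by (auto simp: unital_star_hom_def)
  have "isometry (f (t i))" if "i \<ge> 1" for i
  proof -
    have "(t i)\<^sup>\<star> * t i = 1" using t that by (simp add: cuntz_family_def isometry_def)
    then show ?thesis using f1 fp(2)[of "t i" "t i"] by (simp add: isometry_def)
  qed
  moreover have "(\<Sum>i=1..m. f (t i) * (f (t i))\<^sup>\<star>) \<preceq> 1" if "m \<ge> 1" for m
  proof -
    have "(\<Sum>i=1..m. t i * (t i)\<^sup>\<star>) \<preceq> 1" using t that by (simp add: cuntz_family_def)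
    from unital_star_hom_le[OF f this] show ?thesis
      by (simp add: unital_star_hom_sum[OF f] f1 fp)
  qed
  ultimately show ?thesis by (simp add: cuntz_family_def)
qed

theorem corollary19:
  fixes n :: nat
    and s :: "nat \<Rightarrow> 'a::unital_cstar_algebra"
    and t :: "nat \<Rightarrow> 'b::unital_cstar_algebra"
    and f :: "'b \<Rightarrow> 'a"
  assumes "n \<ge> 2"
    and "cuntz_algebra n s"
    and "cuntz_algebra_infinity t"
    and "unital_embedding f"
    and "\<And>k i. i \<in> {1..n - 1} \<Longrightarrow> f (t ((n - 1) * k + i)) = s n ^ k * s i"
  shows "cuntz_family (\<lambda>i. f (t i)) \<and> separates_points (\<lambda>i. f (t i))"
proof
  show "cuntz_family (\<lambda>i. f (t i))"
  proof (rule unital_star_hom_cuntz_family[of f t])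
    show "unital_star_hom f" using assms(4) by (simp add: unital_embedding_def)
    show "cuntz_family t" using assms(3) by (simp add: cuntz_algebra_infinity_def)
  qed
  interpret cuntz_generators n s
    using assms(1,2) by unfold_locales (auto simp: cuntz_algebra_def)
  have "x = 0"
    if x: "\<forall>i\<ge>1. \<forall>j\<ge>1. (f (t i) * (f (t i))\<^sup>\<star>) * x * (f (t j) * (f (t j))\<^sup>\<star>) = 0" for x
  proof (rule eq_0_if_tail_complements_kill)
    fix K L
    \<comment> \<open>Expanding both complements by \<open>tail_complement\<close> produces only
      terms of this form. Since \<open>i\<close> and \<open>j\<close> are at least 1, so are the
      corresponding indices of \<open>t\<close>, as the hypothesis on \<open>x\<close>
      demands.\<close>
    have "((s n ^ k * s i) * (s n ^ k * s i)\<^sup>\<star>) * x * ((s n ^ l * s j) * (s n ^ l * s j)\<^sup>\<star>) = 0"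
      if i: "i \<in> {1..n-1}" and j: "j \<in> {1..n-1}" for k i l j
    proof -
      have "(n - 1) * k + i \<ge> 1" "(n - 1) * l + j \<ge> 1" using i j by auto
      from x[rule_format, OF this] show ?thesis by (simp only: assms(5)[OF i] assms(5)[OF j])
    qed
    then show "(1 - tail K) * x * (1 - tail L) = 0"
      unfolding tail_complement sum_distrib_left sum_distrib_right
      by (intro sum.neutral ballI)
  qed
  then show "separates_points (\<lambda>i. f (t i))" unfolding separates_points_def by auto
qed

end
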